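(* Let $N_r,N_y,N_v\ge 1$ be integers and let $G\in\mathbb{C}^{N_r\times N_y}$ have columns $g_1,\dots,g_{N_y}$ with $\|g_j\|_2=1$ for all $j$ and $|\mu(g_j,g_q)|<1$ for all $j\neq q$. Suppose that $X\in\mathbb{C}^{N_y\times N_v}$ has row support $\mathcal{S}$ with cardinality $1<|\mathcal{S}|\le N_v$, and that its nonzero rows are orthogonal. Then the multiple view interaction coefficient of $X$ is given by $$\mathcal{I}_{N_v}=\max_{1\le j\le N_y}\sqrt{\sum_{q\in\mathcal{S}\setminus\{n(j)\}}|\mu(g_j,g_q)|^2}\,.$$
   Context: Rows of $X$ are denoted $x_{j\rightarrow}$. The row support of $X$ is the set $\mathcal{S}\subset\{1,\dots,N_y\}$ of indices of its nonzero rows. $\star$ denotes conjugate transpose. Orthogonality of rows is with respect to the Hermitian inner product $\langle v,x\rangle=v x^\star$ on $\mathbb{C}^{1\times N_v}$ (pairwise orthogonality). For columns of $G$, $\mu(g_j,g_q)=g_j^\star g_q$. For nonzero row vectors $v,x\in\mathbb{C}^{1\times N_v}$, $\mu(v,x)=\dfrac{v x^\star}{\|v\|_2\|x\|_2}$. The semimetric is $\mathfrak{D}(j,q)=1-|\mu(g_j,g_q)|$. For each $j\in\{1,\dots,N_y\}$, $n(j)\in\mathcal{S}$ is an index minimizing $\mathfrak{D}(j,q)$ over $q\in\mathcal{S}$ (if the minimizer is not unique, one is picked and fixed). The multiple view interaction coefficient of $X$ is $$\mathcal{I}_{N_v}=\max_{1\le j\le N_y}\ \sup_{0\ne v\in\mathbb{C}^{1\times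 N_v}}\ \sum_{q\in\mathcal{S}\setminus\{n(j)\}}|\mu(g_j,g_q)|\,|\mu(v,x_{q\rightarrow})|.$$ *)

theory Defs
  imports "HOL-Analysis.Analysis"
begin

(* An element of complex^'c^'r is a matrix with rows indexed by 'r and columns
   indexed by 'c, and norm on complex^'n is the Euclidean (l2) norm. *)

definition column_mu :: "complex^'r \<Rightarrow> complex^'r \<Rightarrow> complex"
  where "column_mu g h = (\<Sum>i\<in>UNIV. cnj (g $ i) * h $ i)"

(* The Hermitian inner product on row vectors, linear in the first argument. *)
definition row_inner :: "complex^'v \<Rightarrow> complex^'v \<Rightarrow> complex"
  where "row_inner v x = (\<Sum>i\<in>UNIV. v $ i * cnj (x $ i))"

(* Only meant for nonzero v and x. *)
definition row_mu :: "complex^'v \<Rightarrow> complex^'v \<Rightarrow> complex"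
  where "row_mu v x = row_inner v x / of_real (norm v * norm x)"

definition row_support :: "complex^'v^'y \<Rightarrow> 'y set"
  where "row_support X = {j. row j X \<noteq> 0}"

definition semimetric :: "complex^'y^'r \<Rightarrow> 'y \<Rightarrow> 'y \<Rightarrow> real"
  where "semimetric G j q = 1 - cmod (column_mu (column j G) (column q G))"

(* The minimizer need not be unique: n is any fixed choice of minimizers. *)
definition nearest_choice :: "complex^'y^'r \<Rightarrow> 'y set \<Rightarrow> ('y \<Rightarrow> 'y) \<Rightarrow> bool"
  where "nearest_choice G S n \<longleftrightarrow> (\<forall>j. is_arg_min (semimetric G j) (\<lambda>q. q \<in> S) (n j))"

definition interaction_sum ::
  "complex^'y^'r \<Rightarrow> complex^'v^'y \<Rightarrow> ('y \<Rightarrow> 'y) \<Rightarrow> 'y \<Rightarrow> complex^'v \<Rightarrow> real"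
  where "interaction_sum G X n j v =
    (\<Sum>q\<in>row_support X - {n j}.
        cmod (column_mu (column j G) (column q G)) * cmod (row_mu v (row q X)))"

(* The supremum is taken in the reals; it is over a nonempty set, which is bounded
   by bdd_above_interaction_sum below. *)
definition interaction_coeff ::
  "complex^'y^'r \<Rightarrow> complex^'v^'y \<Rightarrow> ('y::finite \<Rightarrow> 'y) \<Rightarrow> real"
  where "interaction_coeff G X n =
    Max (range (\<lambda>j. SUP v\<in>{v. v \<noteq> 0}. interaction_sum G X n j v))"

lemma cmod_row_inner_le: "cmod (row_inner v x) \<le> norm v * norm x"
proof -
  have "cmod (row_inner v x) \<le> (\<Sum>i\<in>UNIV. \<bar>cmod (v $ i)\<bar> * \<bar>cmod (x $ i)\<bar>)"
    unfolding row_inner_def by (rule order_trans[OF norm_sum]) (simp add: norm_mult)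
  also have "\<dots> \<le> norm v * norm x"
    unfolding norm_vec_def by (rule L2_set_mult_ineq)
  finally show ?thesis .
qed

lemma cmod_row_mu_le_1: "cmod (row_mu v x) \<le> 1"
  using cmod_row_inner_le[of v x]
  by (auto simp: row_mu_def norm_divide norm_mult divide_le_eq_1 zero_less_mult_iff)

lemma bdd_above_interaction_sum: "bdd_above (interaction_sum G X n j ` A)"
proof (rule bdd_aboveI2)
  fix v
  show "interaction_sum G X n j v
    \<le> (\<Sum>q\<in>row_support X - {n j}. cmod (column_mu (column j G) (column q G)))"
    unfolding interaction_sum_def
    by (intro sum_mono mult_left_le cmod_row_mu_le_1 norm_ge_zero)
qed

end

(* Writing u q = x q / norm (x q) and choosing phases c q of modulus 1, the sum over q of
   a q * |mu(v, x q)| is <v, w> / norm v for w = sum of a q * c q * u q. Pythagoras gives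
   norm w = sqrt (sum of a q^2), so Cauchy-Schwarz bounds the sum, and v = sum of a q * u q
   attains the bound. Hence the supremum is computed exactly for each j separately. *)

theory Submission
  imports Defs
begin

lemma row_inner_self: "row_inner v v = of_real ((norm v)\<^sup>2)"
proof -
  have "(norm v)\<^sup>2 = (\<Sum>i\<in>UNIV. (cmod (v $ i))\<^sup>2)"
    by (simp add: norm_vec_def L2_set_def sum_nonneg)
  then show ?thesis
    by (simp add: row_inner_def complex_norm_square[symmetric])
qed

lemma row_inner_sum_left:
  "row_inner (\<Sum>q\<in>T. c q *s x q) v = (\<Sum>q\<in>T. c q * row_inner (x q) v)"
proof -
  have "row_inner (\<Sum>q\<in>T. c q *s x q) v = (\<Sum>i\<in>UNIV. \<Sum>q\<in>T. c q * (x q $ i * cnj (v $ i)))"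
    by (simp add: row_inner_def sum_distrib_right mult.assoc)
  also have "\<dots> = (\<Sum>q\<in>T. \<Sum>i\<in>UNIV. c q * (x q $ i * cnj (v $ i)))"
    by (rule sum.swap)
  finally show ?thesis
    by (simp add: row_inner_def sum_distrib_left)
qed

lemma cnj_row_inner: "cnj (row_inner v x) = row_inner x v"
  by (simp add: row_inner_def mult.commute)

lemma row_inner_sum_right:
  "row_inner v (\<Sum>q\<in>T. c q *s x q) = (\<Sum>q\<in>T. cnj (c q) * row_inner v (x q))"
proof -
  have "row_inner v (\<Sum>q\<in>T. c q *s x q) = cnj (row_inner (\<Sum>q\<in>T. c q *s x q) v)"
    by (simp add: cnj_row_inner)
  then show ?thesis
    by (simp add: row_inner_sum_left cnj_row_inner)
qed

text \<open>The vector with coordinates \<open>c q\<close> in the system of normalized vectors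
  \<open>x q / norm (x q)\<close>, which is orthonormal on \<open>T\<close> when the
  \<open>x q\<close> are nonzero and pairwise orthogonal.\<close>

definition normalized_combination :: "('q \<Rightarrow> complex) \<Rightarrow> ('q \<Rightarrow> complex^'v) \<Rightarrow> 'q set \<Rightarrow> complex^'v"
  where "normalized_combination c x T = (\<Sum>q\<in>T. (c q / of_real (norm (x q))) *s x q)"

text \<open>Orthogonality leaves only the term \<open>p = q\<close>, where normalization cancels one
  of two factors \<open>norm (x q)\<close>. If \<open>x q = 0\<close>, both sides are 0.\<close>

lemma row_inner_normalized_combination:
  assumes "finite T" "pairwise (\<lambda>p q. row_inner (x p) (x q) = 0) T" "q \<in> T"
  shows "row_inner (normalized_combination c x T) (x q) = c q * of_real (norm (x q))"
proof -
  have "row_inner (normalized_combination c x T) (x q)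
      = (\<Sum>p\<in>T. if p = q then c q / of_real (norm (x q)) * row_inner (x q) (x q) else 0)"
    unfolding normalized_combination_def row_inner_sum_left
    using assms(2,3) by (intro sum.cong) (auto simp: pairwise_def)
  then show ?thesis
    using assms(1,3) by (simp add: row_inner_self power2_eq_square)
qed

lemma norm_normalized_combination:
  assumes "finite T" "pairwise (\<lambda>p q. row_inner (x p) (x q) = 0) T"
    and "\<And>q. q \<in> T \<Longrightarrow> x q \<noteq> 0"
  shows "norm (normalized_combination c x T) = sqrt (\<Sum>q\<in>T. (cmod (c q))\<^sup>2)"
proof -
  let ?w = "normalized_combination c x T"
  have "row_inner ?w ?w = (\<Sum>q\<in>T. cnj (c q / of_real (norm (x q))) * row_inner ?w (x q))"
    \<comment> \<open>Only the second argument is expanded; the first stays folded, so that each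
      remaining inner product is a known coordinate.\<close>
    by (subst (2) normalized_combination_def) (rule row_inner_sum_right)
  also have "\<dots> = (\<Sum>q\<in>T. of_real ((cmod (c q))\<^sup>2))"
    using assms
    by (intro sum.cong) (auto simp: row_inner_normalized_combination complex_norm_square[symmetric]
        mult.commute[of "cnj _"])
  finally have "of_real ((norm ?w)\<^sup>2) = (of_real (\<Sum>q\<in>T. (cmod (c q))\<^sup>2) :: complex)"
    by (simp add: row_inner_self)
  then have "(norm ?w)\<^sup>2 = (\<Sum>q\<in>T. (cmod (c q))\<^sup>2)"
    by (simp only: of_real_eq_iff)
  then show ?thesis
    by (metis norm_ge_zero real_sqrt_unique)
qed

lemma sum_cmod_row_mu_le:
  assumes "finite T" "pairwise (\<lambda>p q. row_inner (x p) (x q) = 0) T"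
    and nz: "\<And>q. q \<in> T \<Longrightarrow> x q \<noteq> 0"
    and "v \<noteq> 0"
  shows "(\<Sum>q\<in>T. a q * cmod (row_mu v (x q))) \<le> sqrt (\<Sum>q\<in>T. (a q)\<^sup>2)"
proof -
  \<comment> \<open>\<open>row_inner\<close> is conjugate-linear in its second argument, so the
    phase \<open>sgn\<close> of each inner product turns that product into its modulus.\<close>
  define c where "c q = of_real (a q) * sgn (row_inner v (x q))" for q
  let ?w = "normalized_combination c x T"
  have phase: "cnj (sgn z) * z = of_real (cmod z)" for z :: complex
    by (cases "z = 0")
      (simp_all add: sgn_div_norm scaleR_conv_of_real field_simps complex_norm_square[symmetric]
        power2_eq_square)
  have "row_inner v ?w = (\<Sum>q\<in>T. of_real (norm v * (a q * cmod (row_mu v (x q)))))"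
    unfolding normalized_combination_def row_inner_sum_right
  proof (rule sum.cong[OF refl])
    fix q
    assume "q \<in> T"
    have "cnj (c q / of_real (norm (x q))) * row_inner v (x q)
        = of_real (a q / norm (x q)) * (cnj (sgn (row_inner v (x q))) * row_inner v (x q))"
      by (simp add: c_def)
    also have "\<dots> = of_real (norm v * (a q * cmod (row_mu v (x q))))"
      using nz[OF \<open>q \<in> T\<close>] \<open>v \<noteq> 0\<close>
      by (simp add: phase row_mu_def norm_divide norm_mult)
    finally show "cnj (c q / of_real (norm (x q))) * row_inner v (x q)
        = of_real (norm v * (a q * cmod (row_mu v (x q))))" .
  qed
  then have "row_inner v ?w = of_real (norm v * (\<Sum>q\<in>T. a q * cmod (row_mu v (x q))))"
    by (simp add: sum_distrib_left)
  \<comment> \<open>The weights may have any sign here, so the real sum is only bounded by its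
    modulus.\<close>
  then have "norm v * (\<Sum>q\<in>T. a q * cmod (row_mu v (x q))) \<le> cmod (row_inner v ?w)"
    by (metis abs_ge_self norm_of_real)
  also have "\<dots> \<le> norm v * norm ?w"
    by (rule cmod_row_inner_le)
  finally have "(\<Sum>q\<in>T. a q * cmod (row_mu v (x q))) \<le> norm ?w"
    using \<open>v \<noteq> 0\<close> by simp
  also have "\<dots> = sqrt (\<Sum>q\<in>T. (cmod (c q))\<^sup>2)"
    by (rule norm_normalized_combination) (use assms in auto)
  \<comment> \<open>Since \<open>sgn 0 = 0\<close>, the modulus of \<open>c q\<close> is
    \<open>\<bar>a q\<bar>\<close> or 0.\<close>
  also have "\<dots> \<le> sqrt (\<Sum>q\<in>T. (a q)\<^sup>2)"
    by (intro real_sqrt_le_mono sum_mono) (simp add: c_def norm_mult norm_sgn)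
  finally show ?thesis .
qed

text \<open>Nonnegative weights make the Cauchy-Schwarz bound sharp: a negative weight would lower
  the sum, while its square raises the bound.\<close>

lemma SUP_sum_cmod_row_mu:
  fixes x :: "'q \<Rightarrow> complex^'v"
  assumes "finite T" "pairwise (\<lambda>p q. row_inner (x p) (x q) = 0) T"
    and "\<And>q. q \<in> T \<Longrightarrow> x q \<noteq> 0"
    and nonneg: "\<And>q. q \<in> T \<Longrightarrow> 0 \<le> a q"
  shows "(SUP v\<in>{v. v \<noteq> 0}. \<Sum>q\<in>T. a q * cmod (row_mu v (x q))) = sqrt (\<Sum>q\<in>T. (a q)\<^sup>2)"
proof -
  have "\<exists>v. v \<noteq> 0 \<and> sqrt (\<Sum>q\<in>T. (a q)\<^sup>2) \<le> (\<Sum>q\<in>T. a q * cmod (row_mu v (x q)))"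
  proof (cases "\<forall>q\<in>T. a q = 0")
    case True
    \<comment> \<open>With all weights zero the extremal combination is the zero vector, which is
      excluded. Both sides are then 0 at any nonzero vector, such as the all-ones vector.\<close>
    have "(1 :: complex^'v) \<noteq> 0"
      by simp
    with True show ?thesis
      by (intro exI[of _ 1]) simp
  next
    case False
    define w where "w = normalized_combination (\<lambda>q. of_real (a q)) x T"
    have norm_w: "norm w = sqrt (\<Sum>q\<in>T. (a q)\<^sup>2)"
      unfolding w_def by (subst norm_normalized_combination) (use assms in auto)
    have "(\<Sum>q\<in>T. (a q)\<^sup>2) \<noteq> 0"
      using False assms(1) by (simp add: sum_nonneg_eq_0_iff)
    then have "w \<noteq> 0"
      using norm_w by auto
    \<comment> \<open>The coordinate of \<open>w\<close> along the normalized \<open>x q\<close> is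
      \<open>a q\<close>, already nonnegative, so \<open>row_mu w (x q)\<close> has modulus
      \<open>a q / norm w\<close>.\<close>
    have "a q * cmod (row_mu w (x q)) = (a q)\<^sup>2 / norm w" if "q \<in> T" for q
      using assms that \<open>w \<noteq> 0\<close>
      by (simp add: row_mu_def w_def row_inner_normalized_combination norm_divide norm_mult
          power2_eq_square)
    then have "(\<Sum>q\<in>T. a q * cmod (row_mu w (x q))) = (\<Sum>q\<in>T. (a q)\<^sup>2) / norm w"
      by (simp add: sum_divide_distrib)
    also have "\<dots> = norm w"
      by (simp add: norm_w real_div_sqrt sum_nonneg)
    finally show ?thesis
      using \<open>w \<noteq> 0\<close> norm_w by auto
  qed
  then obtain v where "v \<noteq> 0"
    and v: "sqrt (\<Sum>q\<in>T. (a q)\<^sup>2) \<le> (\<Sum>q\<in>T. a q * cmod (row_mu v (x q)))"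
    by blast
  show ?thesis
  \<comment> \<open>An upper bound attained at \<open>v\<close> is a maximum, hence the real
    supremum.\<close>
  proof (rule cSup_eq_maximum)
    have "sqrt (\<Sum>q\<in>T. (a q)\<^sup>2) = (\<Sum>q\<in>T. a q * cmod (row_mu v (x q)))"
      using sum_cmod_row_mu_le[OF assms(1-3) \<open>v \<noteq> 0\<close>] v by (rule antisym[rotated])
    then show "sqrt (\<Sum>q\<in>T. (a q)\<^sup>2) \<in> (\<lambda>v. \<Sum>q\<in>T. a q * cmod (row_mu v (x q))) ` {v. v \<noteq> 0}"
      using \<open>v \<noteq> 0\<close> by blast
  qed (use sum_cmod_row_mu_le[OF assms(1-3)] in auto)
qed

theorem proposition2p3:
  fixes G :: "complex^'y^'r" and X :: "complex^'v^'y" and n :: "'y::finite \<Rightarrow> 'y"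
  assumes "\<And>j. norm (column j G) = 1"
    and "\<And>j q. j \<noteq> q \<Longrightarrow> cmod (column_mu (column j G) (column q G)) < 1"
    and "1 < card (row_support X)" and "card (row_support X) \<le> CARD('v)"
    and "pairwise (\<lambda>j q. row_inner (row j X) (row q X) = 0) (row_support X)"
    and "nearest_choice G (row_support X) n"
  shows "interaction_coeff G X n =
    Max (range (\<lambda>j. sqrt (\<Sum>q\<in>row_support X - {n j}.
      (cmod (column_mu (column j G) (column q G)))\<^sup>2)))"
proof -
  have "(SUP v\<in>{v. v \<noteq> 0}. interaction_sum G X n j v)
      = sqrt (\<Sum>q\<in>row_support X - {n j}. (cmod (column_mu (column j G) (column q G)))\<^sup>2)" for j
    unfolding interaction_sum_def
  \<comment> \<open>For fixed \<open>j\<close> the column coherences are the weights. Removing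
    \<open>n j\<close> keeps the remaining rows nonzero and orthogonal.\<close>
  proof (rule SUP_sum_cmod_row_mu)
    show "pairwise (\<lambda>p q. row_inner (row p X) (row q X) = 0) (row_support X - {n j})"
      using assms(5) by (rule pairwise_subset) blast
  qed (auto simp: row_support_def)
  then show ?thesis
    by (simp add: interaction_coeff_def)
qed

end
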